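(* Let $a>0$ with $a\neq 1$, and let $\sigma:\mathbb{R}\to\mathbb{R}$ be a twice differentiable function with $\sigma(t)>0$, $\sigma'(t)>0$ and $\sigma''(t)>0$ for all $t>0$, and such that $$t\,\sigma''(t)\,\sigma(t)+\sigma(t)\,\sigma'(t)\ \ge\ t\,(\sigma'(t))^2\qquad\text{for all } t>0.$$ Let $A\in\mathbb{R}^{N\times N}$ be the adjacency matrix of a graph on $N$ vertices, let $d_0,d_1,d_2\ge 1$, and let $X\in\mathbb{R}^{N\times d_0}$ have all entries strictly positive. For $W=(W_0,W_1)$ with $W_0\in\mathbb{R}^{d_0\times d_1}$ and $W_1\in\mathbb{R}^{d_1\times d_2}$, let $$f_{a,2}(X,W)=A\,\sigma\big(A X a^{W_0}\big)\,a^{W_1}\in\mathbb{R}^{N\times d_2}$$ be the two-layer exponential graph convolutional network. Then $f_{a,2}(X,W)$ is a Parameter Convex Neural Network, i.e. it is convex with respect to $W$.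
   Context: For a real matrix $M$ and $a>0$, $a^{M}$ denotes the matrix of the same size with entries $a^{M_{ij}}$ (entrywise exponential); products such as $AXa^{W_0}$ are ordinary matrix products. A scalar function $\sigma$ applied to a matrix acts entrywise. A matrix- or vector-valued function of parameters $W$ (a tuple of matrices) is called convex with respect to $W$ if each of its entries is a convex real-valued function of the column vector obtained by listing all the entries of $W$. A neural network $F(X,\theta)$ with input $X$ and parameters $\theta$ is a Parameter Convex Neural Network (PCNN) if it is convex with respect to $\theta$ (for each admissible fixed input $X$). *)

theory Defs
  imports "HOL-Analysis.Analysis" "Graph_Theory.Digraph"
begin

text \<open>An $m \times n$ real matrix is of type \<open>real ^ 'n ^ 'm\<close>: the index type of the columns comes
  first.\<close>

text \<open>The entry at \<open>(u, v)\<close> is the number of arcs from \<open>u\<close> to \<open>v\<close>, so the matrix has entries 0 and 1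
  when there are no parallel arcs. As in the library, an undirected graph is a symmetric digraph.\<close>

definition adjacency_matrix :: "('n::finite, 'e) pre_digraph \<Rightarrow> real ^ 'n ^ 'n" where
  "adjacency_matrix G = (\<chi> u v. of_nat (card {e \<in> arcs G. tail G e = u \<and> head G e = v}))"

definition matrix_exponential :: "real \<Rightarrow> real ^ 'n ^ 'm \<Rightarrow> real ^ 'n ^ 'm" where
  "matrix_exponential a M = map_matrix (\<lambda>x. a powr x) M"

definition exponential_gcn2 ::
  "real \<Rightarrow> (real \<Rightarrow> real) \<Rightarrow> real ^ 'n ^ 'n \<Rightarrow> real ^ 'd0 ^ 'n
    \<Rightarrow> (real ^ 'd1 ^ 'd0) \<times> (real ^ 'd2 ^ 'd1) \<Rightarrow> real ^ 'd2 ^ 'n"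
where
  "exponential_gcn2 a \<sigma> A X W =
     A ** map_matrix \<sigma> (A ** X ** matrix_exponential a (fst W)) ** matrix_exponential a (snd W)"

text \<open>Tuples of matrices form a real vector space with componentwise operations, so convexity in the
  tuple is convexity in the column vector of all its entries; \<open>convex_wrt_params_iff_column\<close> below
  states this explicitly for pairs of matrices.\<close>

definition convex_wrt_params :: "('w::real_vector \<Rightarrow> real ^ 'n ^ 'm) \<Rightarrow> bool" where
  "convex_wrt_params F \<longleftrightarrow> (\<forall>i j. convex_on UNIV (\<lambda>W. F W $ i $ j))"

definition pcnn :: "'x set \<Rightarrow> ('x \<Rightarrow> 'w::real_vector \<Rightarrow> real ^ 'n ^ 'm) \<Rightarrow> bool" where
  "pcnn inputs F \<longleftrightarrow> (\<forall>X\<in>inputs. convex_wrt_params (F X))"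

definition param_column ::
  "(real ^ 'b ^ 'a) \<times> (real ^ 'd ^ 'c) \<Rightarrow> real ^ (('a \<times> 'b) + ('c \<times> 'd))"
where
  "param_column W = (\<chi> k. case k of Inl (i, j) \<Rightarrow> fst W $ i $ j | Inr (i, j) \<Rightarrow> snd W $ i $ j)"

lemma linear_param_column: "linear param_column"
  by (rule linearI) (auto simp: param_column_def vec_eq_iff split: sum.splits)

lemma bij_param_column:
  "bij (param_column :: (real ^ 'b ^ 'a) \<times> (real ^ 'd ^ 'c) \<Rightarrow> _)" (is "bij ?p")
proof (rule o_bij)
  let ?inv = "\<lambda>v :: real ^ (('a \<times> 'b) + ('c \<times> 'd)).
    ((\<chi> i j. v $ Inl (i, j)) :: real ^ 'b ^ 'a, (\<chi> i j. v $ Inr (i, j)) :: real ^ 'd ^ 'c)"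
  show "?inv \<circ> ?p = id"
    by (auto simp: fun_eq_iff param_column_def vec_eq_iff)
  show "?p \<circ> ?inv = id"
    by (auto simp: fun_eq_iff param_column_def vec_eq_iff split: sum.splits)
qed

lemma convex_wrt_params_iff_column:
  fixes F :: "(real ^ 'b ^ 'a) \<times> (real ^ 'd ^ 'c) \<Rightarrow> real ^ 'n ^ 'm"
  shows "convex_wrt_params F \<longleftrightarrow>
    (\<forall>i j. \<exists>g. convex_on UNIV g \<and> (\<forall>W. F W $ i $ j = g (param_column W)))"
proof -
  let ?p = "param_column :: (real ^ 'b ^ 'a) \<times> (real ^ 'd ^ 'c) \<Rightarrow> _"
  have lin: "?p (u *\<^sub>R x + v *\<^sub>R y) = u *\<^sub>R ?p x + v *\<^sub>R ?p y" for u v x y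
    by (simp only: linear_add[OF linear_param_column] linear_scale[OF linear_param_column])
  have inv1: "inv ?p (?p W) = W" for W
    by (rule inv_f_f[OF bij_is_inj[OF bij_param_column]])
  have inv2: "?p (inv ?p v) = v" for v
    by (rule surj_f_inv_f[OF bij_is_surj[OF bij_param_column]])
  have lin_inv: "inv ?p (u *\<^sub>R x + v *\<^sub>R y) = u *\<^sub>R inv ?p x + v *\<^sub>R inv ?p y" for u v x y
  proof -
    have "?p (u *\<^sub>R inv ?p x + v *\<^sub>R inv ?p y) = u *\<^sub>R x + v *\<^sub>R y"
      by (simp only: lin inv2)
    from arg_cong[OF this, of "inv ?p"] show ?thesis
      by (simp only: inv1)
  qed
  have to_column: "convex_on UNIV (f \<circ> inv ?p)" if "convex_on UNIV f" for f
    using that unfolding convex_on_def comp_def lin_inv by blast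
  have from_column: "convex_on UNIV (g \<circ> ?p)" if "convex_on UNIV g" for g
    using that unfolding convex_on_def comp_def lin by blast
  have eq: "convex_on UNIV f \<longleftrightarrow> (\<exists>g. convex_on UNIV g \<and> (\<forall>W. f W = g (?p W)))" for f :: "_ \<Rightarrow> real"
  proof
    assume "convex_on UNIV f"
    then show "\<exists>g. convex_on UNIV g \<and> (\<forall>W. f W = g (?p W))"
      by (intro exI[of _ "f \<circ> inv ?p"] conjI to_column allI) (simp_all only: comp_apply inv1)
  next
    assume "\<exists>g. convex_on UNIV g \<and> (\<forall>W. f W = g (?p W))"
    then obtain g where g: "convex_on UNIV g" "\<forall>W. f W = g (?p W)"
      by blast
    have "f = g \<circ> ?p"
      by (rule ext) (simp only: comp_apply g(2))
    then show "convex_on UNIV f"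
      using from_column[OF g(1)] by (simp only:)
  qed
  show ?thesis
    unfolding convex_wrt_params_def by (intro iff_allI eq)
qed

end

theory Submission
  imports Defs
begin

text \<open>Positive functions with convex logarithm are closed under sums, products and positive scaling,
  and contain \<open>W \<mapsto> a powr l W\<close> for linear \<open>l\<close>. The differential inequality for \<open>\<sigma>\<close> says exactly that
  \<open>s \<mapsto> ln (\<sigma> (exp s))\<close> has nonnegative second derivative, so \<open>\<sigma>\<close> preserves this class as well. Each
  entry of the network is thus a nonnegative combination of log-convex functions, hence convex.\<close>

section \<open>Log-convex functions and their closure properties\<close>

definition log_convex_on :: "'v::real_vector set \<Rightarrow> ('v \<Rightarrow> real) \<Rightarrow> bool" where
  "log_convex_on S f \<longleftrightarrow> (\<forall>x\<in>S. f x > 0) \<and> convex_on S (\<lambda>x. ln (f x))"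

lemma log_convex_onD:
  assumes "log_convex_on S f"
  shows "\<And>x. x \<in> S \<Longrightarrow> f x > 0" and "convex_on S (\<lambda>x. ln (f x))"
  using assms by (auto simp: log_convex_on_def)

lemma convex_on_mono_compose:
  assumes g: "convex_on UNIV g" "mono g" and f: "convex_on S f"
  shows "convex_on S (\<lambda>x. g (f x))"
proof -
  have "g (f (u *\<^sub>R x + v *\<^sub>R y)) \<le> u * g (f x) + v * g (f y)"
    if "x \<in> S" "y \<in> S" "u \<ge> 0" "v \<ge> 0" "u + v = 1" for x y u v
  proof -
    have "g (f (u *\<^sub>R x + v *\<^sub>R y)) \<le> g (u * f x + v * f y)"
      using f that by (intro monoD[OF g(2)]) (simp add: convex_on_def)
    also have "\<dots> \<le> u * g (f x) + v * g (f y)"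
      using g(1) that by (simp add: convex_on_def)
    finally show ?thesis .
  qed
  then show ?thesis
    using convex_on_imp_convex[OF f] by (simp add: convex_on_def)
qed

lemma linear_imp_convex_on:
  fixes f :: "'v::real_vector \<Rightarrow> real"
  assumes "linear f" "convex S"
  shows "convex_on S f"
  using assms by (simp add: convex_on_def linear_add linear_scale)

lemma convex_on_sum_functions:
  assumes "finite I" "convex S" "\<And>i. i \<in> I \<Longrightarrow> convex_on S (f i)"
  shows "convex_on S (\<lambda>x. \<Sum>i\<in>I. f i x)"
  using assms by (induction I rule: finite_induct) (simp_all add: convex_on_const convex_on_add)

text \<open>On \<open>S\<close>, \<open>f\<close> is \<open>exp\<close> after the convex function
  \<open>ln \<circ> f\<close>, and \<open>exp\<close> is convex and increasing.\<close>

lemma log_convex_on_imp_convex_on: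
  assumes "log_convex_on S f"
  shows "convex_on S f"
proof -
  have "convex_on S (\<lambda>x. exp (ln (f x)))"
    using log_convex_onD(2)[OF assms]
    by (intro convex_on_mono_compose[OF exp_convex]) (auto simp: mono_def)
  moreover have "exp (ln (f x)) = f x" if "x \<in> S" for x
    using log_convex_onD(1)[OF assms that] by simp
  \<comment> \<open>The rewriting is valid only on \<open>S\<close>; unfolding \<open>convex\<close>
    as well puts the convex combinations in \<open>S\<close>, so it applies to them too.\<close>
  ultimately show ?thesis
    unfolding convex_on_def convex_def by auto
qed

lemma log_convex_on_cmult:
  fixes c :: real
  assumes "c > 0" "log_convex_on S f"
  shows "log_convex_on S (\<lambda>x. c * f x)"
proof -
  note pos = log_convex_onD(1)[OF assms(2)]
  have cvx: "convex S"
    using convex_on_imp_convex log_convex_onD(2)[OF assms(2)] by blast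
  have "convex_on S (\<lambda>x. ln c + ln (f x))"
    using log_convex_onD(2)[OF assms(2)] cvx by (simp add: convex_on_add convex_on_const)
  moreover have "ln (c * f x) = ln c + ln (f x)" if "x \<in> S" for x
    using pos[OF that] assms(1) by (simp add: ln_mult)
  ultimately show ?thesis
    using pos assms(1) unfolding log_convex_on_def convex_on_def convex_def by auto
qed

lemma log_convex_on_mult:
  assumes "log_convex_on S f" "log_convex_on S g"
  shows "log_convex_on S (\<lambda>x. f x * g x)"
proof -
  note pos = log_convex_onD(1)[OF assms(1)] log_convex_onD(1)[OF assms(2)]
  have "convex_on S (\<lambda>x. ln (f x) + ln (g x))"
    by (intro convex_on_add log_convex_onD(2) assms)
  moreover have "ln (f x * g x) = ln (f x) + ln (g x)" if "x \<in> S" for x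
    using pos[OF that] by (simp add: ln_mult)
  ultimately show ?thesis
    using pos unfolding log_convex_on_def convex_on_def convex_def by auto
qed

text \<open>Exponentiating the convexity inequality for \<open>ln \<circ> f\<close> turns the
  weighted arithmetic mean of the logarithms into a weighted geometric mean.\<close>

lemma log_convex_on_le_powr:
  assumes "log_convex_on S f" "x \<in> S" "y \<in> S" "u \<ge> 0" "v \<ge> 0" "u + v = 1"
  shows "f (u *\<^sub>R x + v *\<^sub>R y) \<le> f x powr u * f y powr v"
proof -
  have "u *\<^sub>R x + v *\<^sub>R y \<in> S"
    using assms convex_on_imp_convex[OF log_convex_onD(2)[OF assms(1)]] by (auto simp: convex_def)
  then have pos: "f x > 0" "f y > 0" "f (u *\<^sub>R x + v *\<^sub>R y) > 0"
    using log_convex_onD(1)[OF assms(1)] assms by auto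
  have "ln (f (u *\<^sub>R x + v *\<^sub>R y)) \<le> u * ln (f x) + v * ln (f y)"
    using log_convex_onD(2)[OF assms(1)] assms by (simp add: convex_on_def)
  then have "exp (ln (f (u *\<^sub>R x + v *\<^sub>R y))) \<le> exp (u * ln (f x) + v * ln (f y))"
    by (simp only: exp_le_cancel_iff)
  then show ?thesis
    using pos by (simp add: powr_def exp_add)
qed

text \<open>Hoelder's inequality with weights \<open>u\<close> and \<open>v\<close>: after division
  by the right-hand side, Young's inequality bounds each of the two terms by a weighted arithmetic
  mean.\<close>

lemma Hoelder_two_terms:
  fixes p q r s u v :: real
  assumes "p > 0" "q > 0" "r > 0" "s > 0" "u \<ge> 0" "v \<ge> 0" "u + v = 1"
  shows "p powr u * q powr v + r powr u * s powr v \<le> (p + r) powr u * (q + s) powr v"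
proof -
  let ?M = "(p + r) powr u * (q + s) powr v"
  have 1: "(p / (p + r)) powr u * (q / (q + s)) powr v \<le> u * (p / (p + r)) + v * (q / (q + s))"
    using assms by (intro Youngs_inequality_0) auto
  have 2: "(r / (p + r)) powr u * (s / (q + s)) powr v \<le> u * (r / (p + r)) + v * (s / (q + s))"
    using assms by (intro Youngs_inequality_0) auto
  \<comment> \<open>The normalised fractions add up to 1 within each weight, so the two bounds total
    \<open>u + v = 1\<close>.\<close>
  have "u * (p / (p + r)) + v * (q / (q + s)) + (u * (r / (p + r)) + v * (s / (q + s)))
      = u * (p / (p + r) + r / (p + r)) + v * (q / (q + s) + s / (q + s))"
    by (simp only: distrib_left ac_simps)
  also have "\<dots> = 1"
    using assms by (simp flip: add_divide_distrib)
  finally have "(p powr u * q powr v) / ?M + (r powr u * s powr v) / ?M \<le> 1"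
    using 1 2 assms by (simp add: powr_divide)
  then have "(p powr u * q powr v + r powr u * s powr v) / ?M \<le> 1"
    by (simp add: add_divide_distrib)
  moreover have "?M > 0"
    using assms by simp
  ultimately show ?thesis
    by (simp add: divide_le_eq)
qed

text \<open>The logarithm of a sum does not split, so the argument is multiplicative: each summand
  is bounded by a geometric mean, and Hoelder merges the two bounds.\<close>

lemma log_convex_on_add:
  assumes "log_convex_on S f" "log_convex_on S g"
  shows "log_convex_on S (\<lambda>x. f x + g x)"
proof -
  note posf = log_convex_onD(1)[OF assms(1)] and posg = log_convex_onD(1)[OF assms(2)]
  have cvx: "convex S"
    using convex_on_imp_convex log_convex_onD(2)[OF assms(1)] by blast
  have "ln (f (u *\<^sub>R x + v *\<^sub>R y) + g (u *\<^sub>R x + v *\<^sub>R y)) \<le> u * ln (f x + g x) + v * ln (f y + g y)"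
    if *: "x \<in> S" "y \<in> S" "u \<ge> 0" "v \<ge> 0" "u + v = 1" for x y u v
  proof -
    have z: "u *\<^sub>R x + v *\<^sub>R y \<in> S"
      using cvx * by (auto simp: convex_def)
    note pos = posf[OF *(1)] posf[OF *(2)] posg[OF *(1)] posg[OF *(2)] posf[OF z] posg[OF z]
    have "f (u *\<^sub>R x + v *\<^sub>R y) + g (u *\<^sub>R x + v *\<^sub>R y)
        \<le> f x powr u * f y powr v + g x powr u * g y powr v"
      using log_convex_on_le_powr[OF assms(1) *] log_convex_on_le_powr[OF assms(2) *] by simp
    also have "\<dots> \<le> (f x + g x) powr u * (f y + g y) powr v"
      using pos * by (intro Hoelder_two_terms) auto
    finally have "ln (f (u *\<^sub>R x + v *\<^sub>R y) + g (u *\<^sub>R x + v *\<^sub>R y))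
        \<le> ln ((f x + g x) powr u * (f y + g y) powr v)"
      using pos by (intro ln_mono) auto
    also have "\<dots> = u * ln (f x + g x) + v * ln (f y + g y)"
      using pos by (simp add: ln_mult ln_powr)
    finally show ?thesis .
  qed
  then show ?thesis
    using cvx posf posg by (auto simp: log_convex_on_def convex_on_def intro!: add_pos_pos)
qed

lemma log_convex_on_sum:
  assumes "finite I" "I \<noteq> {}" "\<And>i. i \<in> I \<Longrightarrow> log_convex_on S (f i)"
  shows "log_convex_on S (\<lambda>x. \<Sum>i\<in>I. f i x)"
  using assms by (induction I rule: finite_ne_induct) (simp_all add: log_convex_on_add)

text \<open>The logarithm \<open>l x * ln a\<close> is linear, hence convex for either sign of
  \<open>ln a\<close>; this covers bases below 1.\<close>

lemma log_convex_on_powr_linear: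
  fixes l :: "'v::real_vector \<Rightarrow> real"
  assumes "a > 0" "linear l"
  shows "log_convex_on UNIV (\<lambda>x. a powr l x)"
proof -
  have "linear (\<lambda>x. l x * ln a)"
    using assms(2) by (auto intro!: linearI simp: linear_add linear_scale algebra_simps)
  then show ?thesis
    using assms(1) by (simp add: log_convex_on_def ln_powr linear_imp_convex_on)
qed

section \<open>The activation in logarithmic coordinates \<open>t = exp s\<close>\<close>

context
  fixes \<sigma> \<sigma>' \<sigma>'' :: "real \<Rightarrow> real"
  assumes d1: "\<And>t. t > 0 \<Longrightarrow> (\<sigma> has_real_derivative \<sigma>' t) (at t)"
    and d2: "\<And>t. t > 0 \<Longrightarrow> (\<sigma>' has_real_derivative \<sigma>'' t) (at t)"
    and pos: "\<And>t. t > 0 \<Longrightarrow> \<sigma> t > 0"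
    and pos': "\<And>t. t > 0 \<Longrightarrow> \<sigma>' t > 0"
    and ineq: "\<And>t. t > 0 \<Longrightarrow> t * \<sigma>'' t * \<sigma> t + \<sigma> t * \<sigma>' t \<ge> t * (\<sigma>' t)\<^sup>2"
begin

lemma deriv_ln_activation_exp:
  "((\<lambda>s. ln (\<sigma> (exp s))) has_real_derivative \<sigma>' (exp s) * exp s / \<sigma> (exp s)) (at s)"
  by (auto intro!: derivative_eq_intros DERIV_chain2[OF d1] simp: pos)

text \<open>With \<open>t = exp s\<close>, the second derivative is
  \<open>t / (\<sigma> t)\<^sup>2\<close> times the difference of the two sides of
  \<open>ineq\<close>.\<close>

lemma convex_on_ln_activation_exp: "convex_on UNIV (\<lambda>s. ln (\<sigma> (exp s)))"
proof (rule f''_ge0_imp_convex[OF convex_UNIV deriv_ln_activation_exp])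
  fix s :: real
  let ?t = "exp s"
  \<comment> \<open>The quotient rule applied to the first derivative, left unsimplified; the
    factorisation that exposes \<open>ineq\<close> comes afterwards.\<close>
  let ?d = "((\<sigma>'' ?t * ?t * ?t + ?t * \<sigma>' ?t) * \<sigma> ?t - \<sigma>' ?t * ?t * (\<sigma>' ?t * ?t)) / (\<sigma> ?t * \<sigma> ?t)"
  have "\<sigma> ?t \<noteq> 0"
    using pos[of ?t] by simp
  then show "((\<lambda>s. \<sigma>' (exp s) * exp s / \<sigma> (exp s)) has_real_derivative ?d) (at s)"
    by (auto intro!: derivative_eq_intros DERIV_chain2[OF d1] DERIV_chain2[OF d2]
        simp: algebra_simps)
  have "?d = ?t * (?t * \<sigma>'' ?t * \<sigma> ?t + \<sigma> ?t * \<sigma>' ?t - ?t * (\<sigma>' ?t)\<^sup>2) / (\<sigma> ?t * \<sigma> ?t)"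
    by (simp add: algebra_simps power2_eq_square)
  also have "\<dots> \<ge> 0"
    using ineq[of ?t] pos[of ?t] by (intro divide_nonneg_nonneg mult_nonneg_nonneg) auto
  finally show "0 \<le> ?d" .
qed

text \<open>Monotonicity is what allows composition with a convex inner function; it comes from
  \<open>pos\<close> and \<open>pos'\<close>, which make the first derivative positive.\<close>

lemma mono_ln_activation_exp: "mono (\<lambda>s. ln (\<sigma> (exp s)))"
proof (rule monoI)
  fix s r :: real
  assume "s \<le> r"
  then show "ln (\<sigma> (exp s)) \<le> ln (\<sigma> (exp r))"
  proof (rule DERIV_nonneg_imp_nondecreasing)
    fix x
    show "\<exists>y. ((\<lambda>s. ln (\<sigma> (exp s))) has_real_derivative y) (at x) \<and> 0 \<le> y"
      using pos[of "exp x"] pos'[of "exp x"]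
      by (intro exI[of _ "\<sigma>' (exp x) * exp x / \<sigma> (exp x)"] conjI deriv_ln_activation_exp) simp
  qed
qed

text \<open>\<open>ln (\<sigma> (f x))\<close> is the convex increasing map
  \<open>s \<mapsto> ln (\<sigma> (exp s))\<close> evaluated at the convex function
  \<open>s = ln (f x)\<close>.\<close>

lemma log_convex_on_activation:
  assumes "log_convex_on S f"
  shows "log_convex_on S (\<lambda>x. \<sigma> (f x))"
proof -
  have "convex_on S (\<lambda>x. ln (\<sigma> (exp (ln (f x)))))"
    using convex_on_ln_activation_exp mono_ln_activation_exp log_convex_onD(2)[OF assms]
    by (rule convex_on_mono_compose)
  moreover have "exp (ln (f x)) = f x" if "x \<in> S" for x
    using log_convex_onD(1)[OF assms that] by simp
  ultimately show ?thesis
    using log_convex_onD(1)[OF assms] pos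
    unfolding log_convex_on_def convex_on_def convex_def by auto
qed

end

text \<open>An isolated vertex has a zero row, where \<open>\<sigma>\<close> is evaluated at 0, outside the range of its
  positivity hypotheses.\<close>

lemma nonneg_matrix_mult_row_zero_or_positive:
  fixes A :: "real ^ 'm::finite ^ 'n" and X :: "real ^ 'd ^ 'm"
  assumes "\<And>i j. A $ i $ j \<ge> 0" "\<And>i j. X $ i $ j > 0"
  shows "(\<forall>l. (A ** X) $ i $ l = 0) \<or> (\<forall>l. (A ** X) $ i $ l > 0)"
proof (cases "\<forall>j. A $ i $ j = 0")
  case True
  then show ?thesis
    by (simp add: matrix_matrix_mult_def)
next
  case False
  \<comment> \<open>This \<open>j\<close> is fixed before the column \<open>l\<close>: its term is
    positive in every column since \<open>X\<close> is positive.\<close>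
  then obtain j where "A $ i $ j > 0"
    using assms(1) by (metis less_eq_real_def)
  then have "(\<Sum>j\<in>UNIV. A $ i $ j * X $ j $ l) > 0" for l
    using assms
    by (intro sum_pos2[of UNIV j]) (auto intro!: mult_nonneg_nonneg less_imp_le[OF assms(2)])
  then show ?thesis
    by (simp add: matrix_matrix_mult_def)
qed

section \<open>Convexity of the network entries\<close>

theorem theorem5:
  fixes a :: real
    and \<sigma> \<sigma>' \<sigma>'' :: "real \<Rightarrow> real"
    and G :: "('n::finite, 'e) pre_digraph"
  assumes "a > 0" and "a \<noteq> 1"
    and "\<And>t. (\<sigma> has_real_derivative \<sigma>' t) (at t)"
    and "\<And>t. (\<sigma>' has_real_derivative \<sigma>'' t) (at t)"
    and "\<And>t. t > 0 \<Longrightarrow> \<sigma> t > 0"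
    and "\<And>t. t > 0 \<Longrightarrow> \<sigma>' t > 0"
    and "\<And>t. t > 0 \<Longrightarrow> \<sigma>'' t > 0"
    and "\<And>t. t > 0 \<Longrightarrow> t * \<sigma>'' t * \<sigma> t + \<sigma> t * \<sigma>' t \<ge> t * (\<sigma>' t)\<^sup>2"
    and "fin_digraph G" and "verts G = UNIV"
  shows "pcnn {X :: real ^ 'd0 ^ 'n. \<forall>i j. X $ i $ j > 0}
    (exponential_gcn2 a \<sigma> (adjacency_matrix G) ::
      real ^ 'd0 ^ 'n \<Rightarrow> (real ^ 'd1 ^ 'd0) \<times> (real ^ 'd2 ^ 'd1) \<Rightarrow> real ^ 'd2 ^ 'n)"
  unfolding pcnn_def convex_wrt_params_def
proof (intro ballI allI)
  fix X :: "real ^ 'd0 ^ 'n" and i :: 'n and j :: 'd2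
  assume "X \<in> {X. \<forall>i j. X $ i $ j > 0}"
  then have X: "X $ i $ j > 0" for i j
    by simp
  define A :: "real ^ 'n ^ 'n" where "A = adjacency_matrix G"
  have A: "A $ i $ j \<ge> 0" for i j
    by (simp add: A_def adjacency_matrix_def)
  \<comment> \<open>The input of \<open>\<sigma>\<close> at vertex \<open>v\<close> and hidden
    feature \<open>k\<close>; the coefficients from \<open>A ** X\<close> do not depend on
    \<open>W\<close>.\<close>
  define h where "h v k W = (\<Sum>l\<in>UNIV. (A ** X) $ v $ l * a powr (fst W $ l $ k))"
    for v k and W :: "(real ^ 'd1 ^ 'd0) \<times> (real ^ 'd2 ^ 'd1)"
  have expand: "exponential_gcn2 a \<sigma> A X W $ i $ j
      = (\<Sum>k\<in>UNIV. \<Sum>v\<in>UNIV. A $ i $ v * (\<sigma> (h v k W) * a powr (snd W $ k $ j)))" for W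
  proof -
    have inner: "(A ** X ** matrix_exponential a (fst W)) $ v $ k = h v k W" for v k
      by (subst matrix_matrix_mult_def) (simp add: h_def matrix_exponential_def map_matrix_def)
    have "(A ** map_matrix \<sigma> (A ** X ** matrix_exponential a (fst W))) $ i $ k
        = (\<Sum>v\<in>UNIV. A $ i $ v * \<sigma> (h v k W))" for k
      by (subst matrix_matrix_mult_def) (simp add: map_matrix_def inner)
    then show ?thesis
      unfolding exponential_gcn2_def
      by (subst matrix_matrix_mult_def)
        (simp add: matrix_exponential_def map_matrix_def sum_distrib_right mult.assoc)
  qed
  have pow1: "log_convex_on UNIV (\<lambda>W :: (real ^ 'd1 ^ 'd0) \<times> (real ^ 'd2 ^ 'd1). a powr (fst W $ l $ k))"
    for l k by (intro log_convex_on_powr_linear assms linearI) auto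
  have pow2: "log_convex_on UNIV (\<lambda>W :: (real ^ 'd1 ^ 'd0) \<times> (real ^ 'd2 ^ 'd1). a powr (snd W $ k $ j))"
    for k by (intro log_convex_on_powr_linear assms linearI) auto
  \<comment> \<open>Each summand is treated separately, according to whether row \<open>v\<close> of
    \<open>A ** X\<close> vanishes or is positive.\<close>
  have "convex_on UNIV (\<lambda>W. A $ i $ v * (\<sigma> (h v k W) * a powr (snd W $ k $ j)))" for v k
    using nonneg_matrix_mult_row_zero_or_positive[OF A X, of v]
  proof
    assume zero: "\<forall>l. (A ** X) $ v $ l = 0"
    \<comment> \<open>Here \<open>h v k\<close> is identically 0. Continuity carries the sign from
      positive arguments to 0, though \<open>\<sigma> 0\<close> may vanish, so the summand is only
      shown convex, as a nonnegative multiple of an exponential.\<close>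
    have "\<sigma> 0 \<ge> 0"
    proof (rule tendsto_lowerbound)
      show "(\<sigma> \<longlongrightarrow> \<sigma> 0) (at_right 0)"
        using DERIV_isCont[OF assms(3)] by (simp add: isCont_def filterlim_at_split)
      show "\<forall>\<^sub>F t in at_right 0. 0 \<le> \<sigma> t"
        using assms(5) by (auto simp: eventually_at_filter intro!: always_eventually less_imp_le)
    qed simp
    then show ?thesis
      using zero A by (simp add: h_def convex_on_cmul log_convex_on_imp_convex_on[OF pow2])
  next
    assume "\<forall>l. (A ** X) $ v $ l > 0"
    then have "log_convex_on UNIV (h v k)"
      unfolding h_def by (intro log_convex_on_sum log_convex_on_cmult pow1) auto
    then have "log_convex_on UNIV (\<lambda>W. \<sigma> (h v k W))"
      using assms by (intro log_convex_on_activation[of \<sigma> \<sigma>' \<sigma>'']) auto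
    \<comment> \<open>The factor \<open>A $ i $ v\<close> may be 0, so it is applied only after
      passing from log-convexity to convexity.\<close>
    then show ?thesis
      by (intro convex_on_cmul[OF A] log_convex_on_imp_convex_on log_convex_on_mult pow2)
  qed
  then have "convex_on UNIV (\<lambda>W :: (real ^ 'd1 ^ 'd0) \<times> (real ^ 'd2 ^ 'd1).
      exponential_gcn2 a \<sigma> A X W $ i $ j)"
    unfolding expand by (intro convex_on_sum_functions) auto
  then show "convex_on UNIV (\<lambda>W :: (real ^ 'd1 ^ 'd0) \<times> (real ^ 'd2 ^ 'd1).
      exponential_gcn2 a \<sigma> (adjacency_matrix G) X W $ i $ j)"
    by (simp add: A_def)
qed

end
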